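(* Let $\Omega$ be any proper subdomain of $\mathbb{C}$. Let $Y\subset\mathbb{C}$ be a quasi-bounded domain, and let $\hat{Y}$ be the smallest simply connected plane domain containing $Y$. If $Y$ is a Hurwitz non-Lipschitz subdomain of $\hat{Y}$, then $$\eta_\Omega^Y(w)=\eta_\Omega(w)\quad\text{for all } w\in\Omega.$$
   Context: A domain is a nonempty connected open subset of $\mathbb{C}$; $\mathbb{D}$ is the open unit disk. A domain $Y\subset\mathbb{C}$ is quasi-bounded if the smallest simply connected plane domain $\hat{Y}$ containing $Y$ is a proper subset of $\mathbb{C}$. For a proper subdomain $\Omega\subsetneq\mathbb{C}$ and $w\in\Omega$, let $\mathcal{H}(w,\Omega)$ be the family of holomorphic functions $h:\mathbb{D}\to\Omega$ with $h(0)=w$, $h(t)\neq w$ for all $t\in\mathbb{D}\setminus\{0\}$, and $h'(0)>0$. The Hurwitz density of $\Omega$ is $\eta_\Omega(w)=2/r_\Omega(w)$, where $r_\Omega(w)=\max\{h'(0):h\in\mathcal{H}(w,\Omega)\}$. For a proper subdomain $Y\subsetneq\mathbb{C}$ and any domain $\Omega\subset\mathbb{C}$, the generalized Hurwitz density of $\Omega$ with basepoint domain $Y$ is $\eta_\Omega^Y(w)=\inf \eta_Y(s)/|h'(s)|$, the infimum being over all $s\in Y$ and all holomorphic $h:Y\to\Omega$ with $h(s)=w$, $h(t)\ne w$ for all $t\in Y\setminus\{s\}$, and $h'(s)\neq0$; it may equal $+\infty$ (infimum over the empty set). For a subdomain $V$ of a proper subdomain $X\subsetneq\mathbb{C}$,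 the infinitesimal contraction constant is $l_\eta(V,X)=\sup_{w\in V}\eta_X(w)/\eta_V(w)$ (always $\le 1$). $V$ is a Hurwitz Lipschitz subdomain of $X$ if $l_\eta(V,X)<1$, and a Hurwitz non-Lipschitz subdomain of $X$ otherwise, i.e. if $l_\eta(V,X)=1$. *)

theory Defs
  imports "HOL-Complex_Analysis.Complex_Analysis" "HOL-Library.Extended_Real"
begin

definition plane_domain :: "complex set \<Rightarrow> bool" where
  "plane_domain S \<longleftrightarrow> S \<noteq> {} \<and> open S \<and> connected S"

definition proper_plane_domain :: "complex set \<Rightarrow> bool" where
  "proper_plane_domain S \<longleftrightarrow> plane_domain S \<and> S \<noteq> UNIV"

(* LEAST is taken with respect to inclusion; simply_connected_hull_properties below shows
   that for every plane domain Y the least such set exists. *)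
definition simply_connected_hull :: "complex set \<Rightarrow> complex set" where
  "simply_connected_hull Y = (LEAST U. plane_domain U \<and> simply_connected U \<and> Y \<subseteq> U)"

definition quasi_bounded :: "complex set \<Rightarrow> bool" where
  "quasi_bounded Y \<longleftrightarrow> plane_domain Y \<and> simply_connected_hull Y \<noteq> UNIV"

definition hurwitz_family :: "complex \<Rightarrow> complex set \<Rightarrow> (complex \<Rightarrow> complex) set" where
  "hurwitz_family w \<Omega> =
     {h. h holomorphic_on ball 0 1 \<and> h ` ball 0 1 \<subseteq> \<Omega> \<and> h 0 = w \<and>
         (\<forall>t \<in> ball 0 1 - {0}. h t \<noteq> w) \<and> deriv h 0 \<in> \<real> \<and> Re (deriv h 0) > 0}"

definition hurwitz_radius :: "complex set \<Rightarrow> complex \<Rightarrow> real" where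
  "hurwitz_radius \<Omega> w = (GREATEST r. \<exists>h \<in> hurwitz_family w \<Omega>. deriv h 0 = complex_of_real r)"

definition hurwitz_density :: "complex set \<Rightarrow> complex \<Rightarrow> real" where
  "hurwitz_density \<Omega> w = 2 / hurwitz_radius \<Omega> w"

definition generalized_hurwitz_density :: "complex set \<Rightarrow> complex set \<Rightarrow> complex \<Rightarrow> ereal" where
  "generalized_hurwitz_density Y \<Omega> w =
     Inf {ereal (hurwitz_density Y s / norm (deriv h s)) | h s.
            s \<in> Y \<and> h holomorphic_on Y \<and> h ` Y \<subseteq> \<Omega> \<and> h s = w \<and>
            (\<forall>t \<in> Y - {s}. h t \<noteq> w) \<and> deriv h s \<noteq> 0}"

definition hurwitz_contraction_constant :: "complex set \<Rightarrow> complex set \<Rightarrow> ereal" where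
  "hurwitz_contraction_constant V X =
     (SUP w \<in> V. ereal (hurwitz_density X w / hurwitz_density V w))"

definition hurwitz_lipschitz_subdomain :: "complex set \<Rightarrow> complex set \<Rightarrow> bool" where
  "hurwitz_lipschitz_subdomain V X \<longleftrightarrow>
     plane_domain V \<and> proper_plane_domain X \<and> V \<subseteq> X \<and> hurwitz_contraction_constant V X < 1"

(* A non-Lipschitz subdomain is in particular a subdomain of a proper domain, so this is not
   the bare negation of hurwitz_lipschitz_subdomain. *)
definition hurwitz_non_lipschitz_subdomain :: "complex set \<Rightarrow> complex set \<Rightarrow> bool" where
  "hurwitz_non_lipschitz_subdomain V X \<longleftrightarrow>
     plane_domain V \<and> proper_plane_domain X \<and> V \<subseteq> X \<and> \<not> hurwitz_lipschitz_subdomain V X"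

lemma least_simply_connected_domain_exists:
  assumes Y: "plane_domain Y"
  obtains G where "plane_domain G" "simply_connected G" "Y \<subseteq> G"
    "\<And>U. plane_domain U \<Longrightarrow> simply_connected U \<Longrightarrow> Y \<subseteq> U \<Longrightarrow> G \<subseteq> U"
proof -
  define I where "I = \<Inter>{U. plane_domain U \<and> simply_connected U \<and> Y \<subseteq> U}"
  obtain y where y: "y \<in> Y" using Y by (auto simp: plane_domain_def)
  define G where "G = connected_component_set (interior I) y"
  have "Y \<subseteq> I" by (auto simp: I_def)
  then have YI: "Y \<subseteq> interior I"
    using Y by (simp add: plane_domain_def interior_maximal)
  have YG: "Y \<subseteq> G"
    unfolding G_def using Y YI y by (intro connected_component_maximal) (auto simp: plane_domain_def)
  have oG: "open G" unfolding G_def by (intro open_connected_component) simp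
  have cG: "connected G" unfolding G_def by simp
  have GI: "G \<subseteq> interior I" unfolding G_def by (rule connected_component_subset)
  have GIs: "G \<subseteq> I" using GI interior_subset by blast
  have wn: "winding_number p z = 0"
    if p: "path p" "path_image p \<subseteq> G" "pathfinish p = pathstart p" and z: "z \<notin> G" for p z
  proof -
    define C where "C = connected_component_set (- path_image p) z"
    have zp: "z \<in> - path_image p" using p z by auto
    have zC: "z \<in> C" using zp by (simp add: C_def)
    have Csub: "C \<subseteq> - path_image p" unfolding C_def by (rule connected_component_subset)
    have conC: "connected C" by (simp add: C_def)
    have oC: "open C" unfolding C_def
      by (intro open_connected_component open_Compl closed_path_image p)
    have "\<not> C \<subseteq> I"
    proof
      assume "C \<subseteq> I"
      then have CI: "C \<subseteq> interior I" using oC by (simp add: interior_maximal)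
      have "C \<noteq> UNIV" using Csub path_image_nonempty[of p] by auto
      then have "frontier C \<noteq> {}" using zC by (metis frontier_eq_empty empty_iff)
      then obtain b where b: "b \<in> frontier C" by auto
      have "C \<in> components (- path_image p)"
        unfolding C_def using zp by (simp add: componentsI)
      then have "frontier C \<subseteq> path_image p"
        using frontier_of_components_closed_complement[of "path_image p" C] closed_path_image[OF p(1)]
        by blast
      then have "b \<in> G" using b p by auto
      moreover have "b \<in> closure C" using b by (simp add: frontier_def)
      ultimately have "G \<inter> C \<noteq> {}"
        using oG by (metis IntI empty_iff open_Int_closure_eq_empty)
      then have "connected (G \<union> C)" using cG conC by (intro connected_Un)
      then have "G \<union> C \<subseteq> G"
        using GI CI y YG connected_component_maximal[of y "G \<union> C" "interior I"]
        by (auto simp: G_def)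
      with zC z show False by auto
    qed
    then obtain x U where x: "x \<in> C" "x \<notin> U" and U: "plane_domain U" "simply_connected U" "Y \<subseteq> U"
      by (auto simp: I_def)
    have "G \<subseteq> U" using GIs U by (auto simp: I_def)
    then have "winding_number p x = 0"
      using U p x simply_connected_eq_winding_number_zero[of U] by (auto simp: plane_domain_def)
    moreover have "winding_number p z = winding_number p x"
      by (rule winding_number_eq[of p z C x]) (use p zC x conC Csub in auto)
    ultimately show ?thesis by simp
  qed
  have "simply_connected G"
    using wn cG simply_connected_eq_winding_number_zero[OF oG] by blast
  moreover have "plane_domain G" using oG cG YG y by (auto simp: plane_domain_def)
  moreover have "G \<subseteq> U" if "plane_domain U" "simply_connected U" "Y \<subseteq> U" for U
    using GIs that unfolding I_def by blast
  ultimately show ?thesis using that YG by blast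
qed

lemma simply_connected_hull_properties:
  assumes "plane_domain Y"
  shows "plane_domain (simply_connected_hull Y)" "simply_connected (simply_connected_hull Y)"
    "Y \<subseteq> simply_connected_hull Y"
    "\<And>U. plane_domain U \<Longrightarrow> simply_connected U \<Longrightarrow> Y \<subseteq> U \<Longrightarrow> simply_connected_hull Y \<subseteq> U"
proof -
  obtain G where G: "plane_domain G" "simply_connected G" "Y \<subseteq> G"
    and least: "\<And>U. plane_domain U \<Longrightarrow> simply_connected U \<Longrightarrow> Y \<subseteq> U \<Longrightarrow> G \<subseteq> U"
    using least_simply_connected_domain_exists[OF assms] by metis
  have "simply_connected_hull Y = G"
    unfolding simply_connected_hull_def using G least by (intro Least_equality) auto
  with G least show "plane_domain (simply_connected_hull Y)"
    "simply_connected (simply_connected_hull Y)" "Y \<subseteq> simply_connected_hull Y"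
    "\<And>U. plane_domain U \<Longrightarrow> simply_connected U \<Longrightarrow> Y \<subseteq> U \<Longrightarrow> simply_connected_hull Y \<subseteq> U"
    by auto
qed

end

theory Submission
  imports Defs
begin

text \<open>
  Postcomposing an extremal map of the disk into \<open>Y\<close> with a competitor for \<open>\<eta>\<^sub>\<Omega>\<^sup>Y\<close>
  gives a competitor for \<open>\<eta>\<^sub>\<Omega>\<close>, whence \<open>\<eta>\<^sub>\<Omega> \<le> \<eta>\<^sub>\<Omega>\<^sup>Y\<close>.  Conversely, choose \<open>s \<in> Y\<close> where the
  densities of \<open>Y\<close> and of its hull almost agree, and precompose an extremal map of the disk into
  \<open>\<Omega>\<close> with a Riemann map of the hull sending \<open>s\<close> to \<open>0\<close>; its restriction to \<open>Y\<close> is an almost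
  optimal competitor for \<open>\<eta>\<^sub>\<Omega>\<^sup>Y\<close>.  Extremal maps exist because the family is normal:
  if \<open>a \<notin> \<Omega>\<close>, the logarithm of \<open>(h - a) / (w - a)\<close>, divided by \<open>2\<pi>\<i>\<close>, omits all nonzero
  integers, so that Schottky's theorem bounds it locally uniformly; and by Hurwitz's theorem a limit
  with nonzero derivative at \<open>0\<close> stays in the family.
\<close>

section \<open>Normality of the Hurwitz family\<close>

lemma hurwitz_familyI:
  assumes "h holomorphic_on ball 0 1" "h ` ball 0 1 \<subseteq> \<Omega>" "h 0 = w"
    "\<And>t. t \<in> ball 0 1 \<Longrightarrow> t \<noteq> 0 \<Longrightarrow> h t \<noteq> w" "deriv h 0 = complex_of_real r" "r > 0"
  shows "h \<in> hurwitz_family w \<Omega>"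
  using assms by (auto simp: hurwitz_family_def)

lemma hurwitz_familyD:
  assumes "h \<in> hurwitz_family w \<Omega>"
  shows "h holomorphic_on ball 0 1" "\<And>t. norm t < 1 \<Longrightarrow> h t \<in> \<Omega>" "h 0 = w"
    "\<And>t. norm t < 1 \<Longrightarrow> h t = w \<Longrightarrow> t = 0"
    "deriv h 0 = complex_of_real (Re (deriv h 0))" "Re (deriv h 0) > 0"
  using assms by (auto simp: hurwitz_family_def image_subset_iff complex_is_Real_iff complex_eq_iff)

text \<open>\<open>Schottky\<close> is applied to the dilation x -> f (t x), which is holomorphic on
  the closed unit disk. The point z becomes z / t there, and \<open>norm z \<le> t\<^sup>2\<close>
  keeps it in the disk of radius t.\<close>

lemma Schottky_ball:
  assumes holf: "f holomorphic_on ball 0 1"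
    and not01: "\<And>z. norm z < 1 \<Longrightarrow> f z \<noteq> 0 \<and> f z \<noteq> 1"
    and f0: "norm (f 0) \<le> r"
    and t: "0 < t" "t < 1" "norm z \<le> t\<^sup>2"
  shows "norm (f z) \<le> exp (pi * exp (pi * (2 + 2 * r + 12 * t / (1 - t))))"
proof -
  have sub: "norm (of_real t * x) < 1" if "norm x \<le> 1" for x :: complex
  proof -
    have "norm (of_real t * x) \<le> t * 1"
      using that t by (auto simp: norm_mult intro!: mult_left_mono)
    then show ?thesis using t by simp
  qed
  have "(f \<circ> (\<lambda>x. of_real t * x)) holomorphic_on cball 0 1"
    by (intro holomorphic_on_compose_gen[where t = "ball 0 1"] holomorphic_intros holf) (auto simp: sub)
  then have "norm ((f \<circ> (\<lambda>x. of_real t * x)) (z / of_real t))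
      \<le> exp (pi * exp (pi * (2 + 2 * r + 12 * t / (1 - t))))"
  proof (rule Schottky)
    show "norm (z / of_real t) \<le> t"
      using t by (simp add: norm_divide divide_le_eq power2_eq_square)
  qed (use f0 not01 sub t in auto)
  then show ?thesis using t by simp
qed

lemma hurwitz_family_locally_bounded:
  assumes a: "a \<notin> \<Omega>" and w: "w \<in> \<Omega>" and K: "compact K" "K \<subseteq> ball 0 1"
  shows "\<exists>B. \<forall>h \<in> hurwitz_family w \<Omega>. \<forall>z \<in> K. norm (h z) \<le> B"
proof -
  obtain t where t: "0 < t" "t < 1" "\<And>z. z \<in> K \<Longrightarrow> norm z \<le> t\<^sup>2"
  proof -
    have "compact (norm ` K)" using K by (intro compact_continuous_image continuous_intros)
    then have "\<exists>s<1. 0 \<le> s \<and> (\<forall>z\<in>K. norm z \<le> s)"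
    proof (cases "K = {}")
      case False
      with \<open>compact (norm ` K)\<close> obtain z where "z \<in> K" "\<forall>x\<in>K. norm x \<le> norm z"
        using compact_attains_sup[of "norm ` K"] by auto
      with K show ?thesis by (intro exI[of _ "norm z"]) auto
    qed (auto intro: exI[of _ 0])
    then obtain s where s: "s < 1" "0 \<le> s" "\<forall>z\<in>K. norm z \<le> s" by blast
    \<comment> \<open>The midpoint of s and 1 lies strictly below 1; its square root serves as t
      because the Schottky bound holds where \<open>norm z \<le> t\<^sup>2\<close>.\<close>
    have "(s + 1) / 2 < 1" "(s + 1) / 2 > 0" "s \<le> (sqrt ((s + 1) / 2))\<^sup>2" using s by auto
    with s show ?thesis by (intro that[of "sqrt ((s + 1) / 2)"]) force+
  qed
  \<comment> \<open>The Schottky bound with r = 1, the norm at 0 of the shifted function F - 1 used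
    below. It depends on t only, hence is common to the whole family.\<close>
  define M where "M = exp (pi * exp (pi * (2 + 2 * 1 + 12 * t / (1 - t))))"
  have "norm (h z) \<le> norm a + norm (w - a) * exp (2 * pi * (1 + M))"
    if h: "h \<in> hurwitz_family w \<Omega>" and z: "z \<in> K" for h z
  proof -
    note hD = hurwitz_familyD[OF h]
    have wa: "w \<noteq> a" using a w by auto
    have "(\<lambda>x. (h x - a) / (w - a)) holomorphic_on ball 0 1"
      using wa by (intro holomorphic_intros hD) auto
    moreover have "(h x - a) / (w - a) \<noteq> 0" if "x \<in> ball 0 1" for x
      using hD(2)[of x] that a wa by auto
    ultimately obtain g where g: "g holomorphic_on ball 0 1"
      and exp_g: "\<And>x. x \<in> ball 0 1 \<Longrightarrow> exp (g x) = (h x - a) / (w - a)"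
      by (rule holomorphic_logarithm_exists[OF convex_ball open_ball, where ?z0.0 = 0]) auto
    \<comment> \<open>Subtracting \<open>g 0\<close> gives F 0 = 0 and leaves the exponential
      unchanged, since \<open>exp (g 0) = 1\<close>.\<close>
    define F where "F x = (g x - g 0) / (2 * of_real pi * \<i>)" for x
    have exp_F: "exp (2 * of_real pi * \<i> * F x) = (h x - a) / (w - a)" if "norm x < 1" for x
      using exp_g[of x] exp_g[of 0] that wa hD(3) by (simp add: F_def exp_diff)
    have F_int: "F x \<noteq> of_int n" if "norm x < 1" "n \<noteq> 0" for x n
    proof
      assume *: "F x = of_int n"
      have "exp (2 * of_real pi * \<i> * F x) = 1"
        unfolding * exp_eq_1 by (auto intro!: exI[of _ n])
      then have "h x = w" using exp_F[OF that(1)] wa by simp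
      then have "x = 0" using hD(4) that by blast
      then show False using * that by (simp add: F_def)
    qed
    \<comment> \<open>F may take the value 0, as it does at the origin, so the omitted pair 1, 2 is
      shifted to 0, 1.\<close>
    have "norm (F z - 1) \<le> M"
      unfolding M_def
    proof (rule Schottky_ball[where f = "\<lambda>z. F z - 1"])
      show "(\<lambda>z. F z - 1) holomorphic_on ball 0 1"
        unfolding F_def by (intro holomorphic_intros g) auto
      show "F x - 1 \<noteq> 0 \<and> F x - 1 \<noteq> 1" if "norm x < 1" for x
        using F_int[OF that, of 1] F_int[OF that, of 2] by (auto simp: algebra_simps)
    qed (use t z in \<open>auto simp: F_def\<close>)
    then have "norm (F z) \<le> 1 + M"
      using norm_triangle_ineq[of "F z - 1" 1] by simp
    then have "norm (2 * of_real pi * \<i> * F z) \<le> 2 * pi * (1 + M)"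
      by (simp add: norm_mult)
    then have "exp (norm (2 * of_real pi * \<i> * F z)) \<le> exp (2 * pi * (1 + M))" by simp
    then have "norm (exp (2 * of_real pi * \<i> * F z)) \<le> exp (2 * pi * (1 + M))"
      using norm_exp order_trans by blast
    moreover have "h z = a + (w - a) * exp (2 * of_real pi * \<i> * F z)"
      using exp_F[of z] z K wa by auto
    ultimately show ?thesis
      by (metis (no_types, lifting) add_left_mono mult_left_mono norm_ge_zero norm_mult norm_triangle_le)
  qed
  then show ?thesis by blast
qed

text \<open>Montel's theorem yields the limit; uniform convergence on a smaller disk passes to the
  derivatives at 0.\<close>

lemma hurwitz_family_convergent_subsequence:
  fixes F :: "nat \<Rightarrow> complex \<Rightarrow> complex"
  assumes a: "a \<notin> \<Omega>" and w: "w \<in> \<Omega>" and F: "\<And>n. F n \<in> hurwitz_family w \<Omega>"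
  obtains g k where "g holomorphic_on ball 0 1" "strict_mono k"
    "\<And>K. compact K \<Longrightarrow> K \<subseteq> ball 0 1 \<Longrightarrow> uniform_limit K (\<lambda>n. F (k n)) g sequentially"
    "(\<lambda>n. deriv (F (k n)) 0) \<longlonglongrightarrow> deriv g 0"
proof -
  obtain g k where gk: "g holomorphic_on ball 0 1" "strict_mono (k :: nat \<Rightarrow> nat)"
    and ul: "\<And>K. compact K \<Longrightarrow> K \<subseteq> ball 0 1 \<Longrightarrow> uniform_limit K (F \<circ> k) g sequentially"
    using Montel[of "ball 0 1" "hurwitz_family w \<Omega>" F]
      hurwitz_familyD(1) hurwitz_family_locally_bounded[OF a w] F
    by (metis image_subsetI open_ball)
  have "(\<lambda>n. deriv ((F \<circ> k) n) 0) \<longlonglongrightarrow> deriv g 0"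
  proof (rule deriv_complex_uniform_limit)
    show "uniform_limit (ball 0 (1/2)) (F \<circ> k) g sequentially"
      by (rule uniform_limit_on_subset[OF ul[of "cball 0 (1/2)"]]) auto
    show "\<forall>\<^sub>F n in sequentially. (F \<circ> k) n holomorphic_on ball 0 (1/2)"
      by (auto intro!: always_eventually holomorphic_on_subset[OF hurwitz_familyD(1)[OF F]])
  qed auto
  with gk ul show ?thesis by (intro that[of g k]) (auto simp: o_def)
qed

section \<open>Extremal maps and the Hurwitz radius\<close>

lemma hurwitz_family_extremal:
  assumes "proper_plane_domain \<Omega>" and w: "w \<in> \<Omega>"
  obtains h where "h \<in> hurwitz_family w \<Omega>"
    "\<And>f. f \<in> hurwitz_family w \<Omega> \<Longrightarrow> Re (deriv f 0) \<le> Re (deriv h 0)"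
proof -
  obtain a where a: "a \<notin> \<Omega>" and op: "open \<Omega>"
    using assms by (auto simp: proper_plane_domain_def plane_domain_def)
  define S where "S = (\<lambda>h. Re (deriv h 0)) ` hurwitz_family w \<Omega>"
  obtain e where e: "e > 0" "ball w e \<subseteq> \<Omega>" using op w openE by blast
  \<comment> \<open>An affine map onto a small disk about w shows that the family is
    nonempty.\<close>
  have "(\<lambda>t. w + of_real e * t) \<in> hurwitz_family w \<Omega>"
  proof (rule hurwitz_familyI)
    show "(\<lambda>t. w + of_real e * t) ` ball 0 1 \<subseteq> \<Omega>"
      using e by (auto simp: dist_norm norm_mult intro!: subsetD[OF e(2)])
    show "deriv (\<lambda>t. w + of_real e * t) 0 = complex_of_real e"
      by (rule DERIV_imp_deriv) (auto intro!: derivative_eq_intros)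
  qed (use e in \<open>auto intro!: holomorphic_intros\<close>)
  then have S_ne: "S \<noteq> {}" by (auto simp: S_def)
  \<comment> \<open>Derivatives exceeding every n would tend to infinity along every subsequence,
    against their convergence along the one from normality.\<close>
  have S_bdd: "bdd_above S"
  proof (rule ccontr)
    assume "\<not> bdd_above S"
    then have "\<exists>h \<in> hurwitz_family w \<Omega>. real n < Re (deriv h 0)" for n
      unfolding S_def bdd_above_def by (auto simp: not_le)
    then obtain F where F: "\<And>n. F n \<in> hurwitz_family w \<Omega>"
      and F_gt: "\<And>n. real n < Re (deriv (F n) 0)" by metis
    obtain g k where k: "strict_mono k" and "(\<lambda>n. deriv (F (k n)) 0) \<longlonglongrightarrow> deriv g 0"
      by (rule hurwitz_family_convergent_subsequence[of a \<Omega> w F, OF a w F]) blast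
    then have "(\<lambda>n. Re (deriv (F (k n)) 0)) \<longlonglongrightarrow> Re (deriv g 0)" by (intro tendsto_intros)
    moreover have "filterlim (\<lambda>n. Re (deriv (F (k n)) 0)) at_top sequentially"
    proof (rule filterlim_at_top_mono[OF filterlim_real_sequentially], intro always_eventually allI)
      fix n show "real n \<le> Re (deriv (F (k n)) 0)"
        using F_gt[of "k n"] seq_suble[OF k, of n] by linarith
    qed
    ultimately show False
      using not_tendsto_and_filterlim_at_infinity filterlim_at_top_imp_at_infinity
        sequentially_bot by blast
  qed
  have "Sup S \<in> closure S" using S_ne S_bdd by (rule closure_contains_Sup)
  then obtain x where x: "\<And>n. x n \<in> S" "x \<longlonglongrightarrow> Sup S" by (auto simp: closure_sequential)
  have "\<exists>h \<in> hurwitz_family w \<Omega>. Re (deriv h 0) = x n" for n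
    using x(1)[of n] by (auto simp: S_def)
  then obtain F where F: "\<And>n. F n \<in> hurwitz_family w \<Omega>"
    and F_x: "\<And>n. Re (deriv (F n) 0) = x n" by metis
  obtain g k where g: "g holomorphic_on ball 0 1" and k: "strict_mono k"
    and ul: "\<And>K. compact K \<Longrightarrow> K \<subseteq> ball 0 1 \<Longrightarrow> uniform_limit K (\<lambda>n. F (k n)) g sequentially"
    and lim: "(\<lambda>n. deriv (F (k n)) 0) \<longlonglongrightarrow> deriv g 0"
    by (rule hurwitz_family_convergent_subsequence[of a \<Omega> w F, OF a w F]) blast
  note FD = hurwitz_familyD[OF F]
  have "deriv (F (k n)) 0 = complex_of_real (x (k n))" for n
    using FD(5) F_x by metis
  then have "(\<lambda>n. deriv (F (k n)) 0) \<longlonglongrightarrow> complex_of_real (Sup S)"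
    using LIMSEQ_subseq_LIMSEQ[OF x(2) k] by (auto simp: o_def intro!: tendsto_intros)
  then have dg: "deriv g 0 = complex_of_real (Sup S)" using lim LIMSEQ_unique by blast
  have S_pos: "Sup S > 0"
  proof -
    obtain s where "s \<in> S" using S_ne by blast
    moreover then have "s > 0" using hurwitz_familyD(6) by (auto simp: S_def)
    ultimately show ?thesis using cSup_upper[OF _ S_bdd] by fastforce
  qed
  \<comment> \<open>Hurwitz's theorem needs a nonconstant limit. By the identity theorem, constancy
    on a nonempty open set would spread to the whole disk and force \<open>deriv g 0 = 0\<close>,
    whereas this derivative is \<open>Sup S > 0\<close>.\<close>
  have nonconst: "\<not> g constant_on U" if U: "open U" "U \<noteq> {}" "U \<subseteq> ball 0 1" for U
  proof
    assume "g constant_on U"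
    then obtain c where c: "\<And>z. z \<in> U \<Longrightarrow> g z = c" by (auto simp: constant_on_def)
    obtain u where "u \<in> U" using U by blast
    have gc: "g z = c" if "z \<in> ball 0 1" for z
    proof (rule analytic_continuation_open[of U "ball 0 1" g "\<lambda>_. c" z])
    qed (use U c g that in auto)
    have "deriv g 0 = deriv (\<lambda>_. c) 0"
      using gc by (intro complex_derivative_transform_within_open[of _ "ball 0 1"] g) auto
    with dg S_pos show False by simp
  qed
  \<comment> \<open>Used twice: on the whole disk with b outside \<Omega>, to keep the image of g in
    \<Omega>, and on the punctured disk with b = w, to keep 0 the only preimage of w.\<close>
  have omit: "g z \<noteq> b"
    if U: "open U" "connected U" "z \<in> U" "U \<subseteq> ball 0 1" and b: "\<And>n t. t \<in> U \<Longrightarrow> F n t \<noteq> b" for U z b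
  proof -
    have "(\<lambda>z. g z - b) z \<noteq> 0"
    proof (rule Hurwitz_no_zeros[of U "\<lambda>n z. F (k n) z - b" "\<lambda>z. g z - b"])
      show "(\<lambda>z. F (k n) z - b) holomorphic_on U" "(\<lambda>z. g z - b) holomorphic_on U" for n
        using U by (auto intro!: holomorphic_intros intro: holomorphic_on_subset[OF FD(1)] holomorphic_on_subset[OF g])
      show "uniform_limit K (\<lambda>n z. F (k n) z - b) (\<lambda>z. g z - b) sequentially"
        if "compact K" "K \<subseteq> U" for K
        using that U by (intro uniform_limit_intros ul) auto
      show "\<not> (\<lambda>z. g z - b) constant_on U"
      proof
        assume "(\<lambda>z. g z - b) constant_on U"
        then obtain c where "\<forall>z\<in>U. g z - b = c" unfolding constant_on_def by blast
        then have "\<forall>z\<in>U. g z = c + b" by (simp add: diff_eq_eq)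
        then have "g constant_on U" unfolding constant_on_def by blast
        with nonconst[of U] U show False by blast
      qed
    qed (use U b in auto)
    then show ?thesis by simp
  qed
  have "g \<in> hurwitz_family w \<Omega>"
  proof (rule hurwitz_familyI)
    show "g ` ball 0 1 \<subseteq> \<Omega>"
    proof clarify
      fix z :: complex assume z: "z \<in> ball 0 1"
      have "g z \<noteq> b" if "b \<notin> \<Omega>" for b
      proof (rule omit[OF _ _ z])
        show "F n t \<noteq> b" if "t \<in> ball 0 1" for n t
          using FD(2)[of t n] that \<open>b \<notin> \<Omega>\<close> by auto
      qed auto
      then show "g z \<in> \<Omega>" by blast
    qed
    have "(\<lambda>n. F (k n) 0) \<longlonglongrightarrow> g 0" using ul[of "{0}"] by (auto intro: tendsto_uniform_limitI)
    then show "g 0 = w" by (simp add: FD(3) LIMSEQ_const_iff)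
    show "g t \<noteq> w" if "t \<in> ball 0 1" "t \<noteq> 0" for t
    proof (rule omit[of "ball 0 1 - {0}"])
      show "connected (ball 0 1 - {0 :: complex})"
        by (rule connected_punctured_ball) simp
    qed (use that FD(4) in \<open>auto simp: open_delete\<close>)
  qed (use g dg S_pos in auto)
  moreover have "Re (deriv f 0) \<le> Re (deriv g 0)" if "f \<in> hurwitz_family w \<Omega>" for f
    using that cSup_upper[OF _ S_bdd] dg by (auto simp: S_def)
  ultimately show ?thesis using that by blast
qed

text \<open>Makes the \<open>GREATEST\<close> in \<open>hurwitz_radius\<close> a genuine maximum, so
  that an extremal map is available to compose with.\<close>

lemma hurwitz_radius_attained:
  assumes "proper_plane_domain \<Omega>" "w \<in> \<Omega>"
  obtains h where "h \<in> hurwitz_family w \<Omega>" "deriv h 0 = complex_of_real (hurwitz_radius \<Omega> w)"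
    "\<And>f. f \<in> hurwitz_family w \<Omega> \<Longrightarrow> Re (deriv f 0) \<le> hurwitz_radius \<Omega> w"
proof -
  obtain h where h: "h \<in> hurwitz_family w \<Omega>"
    and max: "\<And>f. f \<in> hurwitz_family w \<Omega> \<Longrightarrow> Re (deriv f 0) \<le> Re (deriv h 0)"
    using hurwitz_family_extremal[OF assms] by metis
  have "hurwitz_radius \<Omega> w = Re (deriv h 0)"
    unfolding hurwitz_radius_def
  proof (rule Greatest_equality)
    show "\<exists>f\<in>hurwitz_family w \<Omega>. deriv f 0 = complex_of_real (Re (deriv h 0))"
      using h hurwitz_familyD(5) by blast
    show "r \<le> Re (deriv h 0)" if "\<exists>f\<in>hurwitz_family w \<Omega>. deriv f 0 = complex_of_real r" for r
      using that max by force
  qed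
  with h max hurwitz_familyD(5)[OF h] show ?thesis using that by metis
qed

lemma hurwitz_radius_pos:
  assumes "proper_plane_domain \<Omega>" "w \<in> \<Omega>"
  shows "hurwitz_radius \<Omega> w > 0"
  using hurwitz_radius_attained[OF assms] hurwitz_familyD(6) by (metis Re_complex_of_real)

text \<open>Frees the maximality of the radius from the normalisation: precomposing with the
  rotation by the conjugate of \<open>sgn (deriv f 0)\<close> makes the derivative positive without
  changing its modulus.\<close>

lemma norm_deriv_le_hurwitz_radius:
  assumes \<Omega>: "proper_plane_domain \<Omega>" "w \<in> \<Omega>"
    and f: "f holomorphic_on ball 0 1" "f ` ball 0 1 \<subseteq> \<Omega>" "f 0 = w"
      "\<And>t. t \<in> ball 0 1 \<Longrightarrow> t \<noteq> 0 \<Longrightarrow> f t \<noteq> w"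
    and nz: "deriv f 0 \<noteq> 0"
  shows "norm (deriv f 0) \<le> hurwitz_radius \<Omega> w"
proof -
  define u where "u = cnj (sgn (deriv f 0))"
  have u: "norm u = 1" using nz by (simp add: u_def norm_sgn)
  have "(f has_field_derivative deriv f 0) (at (u * 0))"
    using holomorphic_derivI[OF f(1) open_ball, of 0] by simp
  then have "((f \<circ> (\<lambda>t. u * t)) has_field_derivative deriv f 0 * u) (at 0)"
    by (intro DERIV_chain) (auto intro!: derivative_eq_intros)
  moreover have "deriv f 0 * u = complex_of_real (norm (deriv f 0))"
    using nz by (simp add: u_def sgn_eq complex_norm_square[symmetric] field_simps power2_eq_square)
  ultimately have d: "deriv (\<lambda>t. f (u * t)) 0 = complex_of_real (norm (deriv f 0))"
    by (simp add: DERIV_imp_deriv o_def)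
  have "(\<lambda>t. f (u * t)) \<in> hurwitz_family w \<Omega>"
  proof (rule hurwitz_familyI[OF _ _ _ _ d])
    show "(\<lambda>t. f (u * t)) holomorphic_on ball 0 1"
      using holomorphic_on_compose_gen[OF _ f(1), of "\<lambda>t. u * t" "ball 0 1"] u
      by (force simp: o_def norm_mult intro!: holomorphic_intros)
    show "f (u * t) \<noteq> w" if "t \<in> ball 0 1" "t \<noteq> 0" for t
      using that u by (intro f(4)) (auto simp: norm_mult)
  qed (use f u nz in \<open>auto simp: norm_mult\<close>)
  then show ?thesis using hurwitz_radius_attained[OF \<Omega>] d by (metis Re_complex_of_real)
qed

section \<open>Lower bound for the generalized density\<close>

text \<open>For each competitor h and extremal g, the chain rule turns the maximality of the radius
  of \<Omega> into \<open>norm (deriv h s) * hurwitz_radius Y s \<le> hurwitz_radius \<Omega>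
  w\<close>. Without competitors the infimum is +\<infinity> and the bound is trivial.\<close>

lemma hurwitz_density_le_generalized:
  assumes \<Omega>: "proper_plane_domain \<Omega>" "w \<in> \<Omega>" and Y: "proper_plane_domain Y"
  shows "ereal (hurwitz_density \<Omega> w) \<le> generalized_hurwitz_density Y \<Omega> w"
  unfolding generalized_hurwitz_density_def
proof (rule Inf_greatest, clarify)
  fix h s
  assume s: "s \<in> Y" and h: "h holomorphic_on Y" "h ` Y \<subseteq> \<Omega>" "w = h s"
    and ht: "\<forall>t\<in>Y - {s}. h t \<noteq> h s" and nz: "deriv h s \<noteq> 0"
  obtain g where g: "g \<in> hurwitz_family s Y" "deriv g 0 = complex_of_real (hurwitz_radius Y s)"
    using hurwitz_radius_attained[OF Y s] by metis
  note gD = hurwitz_familyD[OF g(1)]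
  have rY: "hurwitz_radius Y s > 0" using hurwitz_radius_pos[OF Y s] .
  have "(h has_field_derivative deriv h s) (at (g 0))"
    using holomorphic_derivI[OF h(1) _ s] Y gD(3) by (simp add: proper_plane_domain_def plane_domain_def)
  moreover have "(g has_field_derivative deriv g 0) (at 0)"
    using holomorphic_derivI[OF gD(1) open_ball, of 0] by simp
  ultimately have d: "deriv (h \<circ> g) 0 = deriv h s * deriv g 0"
    by (intro DERIV_imp_deriv DERIV_chain)
  have "norm (deriv (h \<circ> g) 0) \<le> hurwitz_radius \<Omega> w"
  proof (rule norm_deriv_le_hurwitz_radius[OF \<Omega>])
    show "(h \<circ> g) holomorphic_on ball 0 1"
      using gD(2) by (intro holomorphic_on_compose_gen[OF gD(1) h(1)]) auto
    show "(h \<circ> g) t \<noteq> w" if "t \<in> ball 0 1" "t \<noteq> 0" for t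
      using that gD(2)[of t] gD(4)[of t] ht h(3) by auto
    show "deriv (h \<circ> g) 0 \<noteq> 0" using d nz g(2) rY by simp
  qed (use gD h in auto)
  then have "norm (deriv h s) * hurwitz_radius Y s \<le> hurwitz_radius \<Omega> w"
    using d g(2) rY by (simp add: norm_mult)
  then show "ereal (hurwitz_density \<Omega> (h s)) \<le> ereal (hurwitz_density Y s / norm (deriv h s))"
    using nz rY hurwitz_radius_pos[OF \<Omega>] h(3) by (simp add: hurwitz_density_def field_simps)
qed

section \<open>Upper bound through the Riemann map of the hull\<close>

text \<open>A Riemann map is followed by the disk automorphism that carries the image of s to
  0.\<close>

lemma pointed_Riemann_map:
  assumes S: "open S" "simply_connected S" "S \<noteq> UNIV" "s \<in> S"
  obtains f g where "f holomorphic_on S" "g holomorphic_on ball 0 1" "f s = 0"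
    "\<And>z. z \<in> S \<Longrightarrow> f z \<in> ball 0 1 \<and> g (f z) = z"
    "\<And>z. z \<in> ball 0 1 \<Longrightarrow> g z \<in> S \<and> f (g z) = z"
proof -
  obtain f g where fg: "f holomorphic_on S" "g holomorphic_on ball 0 1"
    "\<And>z. z \<in> S \<Longrightarrow> f z \<in> ball 0 1 \<and> g (f z) = z"
    "\<And>z. z \<in> ball 0 1 \<Longrightarrow> g z \<in> S \<and> f (g z) = z"
    using Riemann_mapping_theorem[of S] S by blast
  have "f s \<in> ball 0 1" using fg(3) S(4) by blast
  then obtain p q where pq: "p (f s) = 0"
    "p holomorphic_on ball 0 1" "p ` ball 0 1 \<subseteq> ball 0 1"
    "q holomorphic_on ball 0 1" "q ` ball 0 1 \<subseteq> ball 0 1"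
    "\<And>z. z \<in> ball 0 1 \<Longrightarrow> p (q z) = z" "\<And>z. z \<in> ball 0 1 \<Longrightarrow> q (p z) = z"
    by (rule ball_biholomorphism_exists) blast
  have in_ball: "p z \<in> ball 0 1" "q z \<in> ball 0 1" if "z \<in> ball 0 1" for z
    using pq(3,5) that by blast+
  show ?thesis
  proof (rule that[of "p \<circ> f" "g \<circ> q"])
    show "(p \<circ> f) holomorphic_on S"
      using fg by (intro holomorphic_on_compose_gen[OF fg(1) pq(2)]) blast
    show "(g \<circ> q) holomorphic_on ball 0 1"
      using pq by (intro holomorphic_on_compose_gen[OF pq(4) fg(2)]) blast
  qed (use fg pq in_ball in \<open>simp_all del: mem_ball\<close>)
qed

text \<open>The ratio of densities is \<open>hurwitz_radius Y s / hurwitz_radius X s\<close>. The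
  inverse Riemann map g is admissible for the radius of X at s, so that radius is at least 1 /
  |f'(s)|; hence c is at most \<open>hurwitz_radius Y s * norm (deriv f s)\<close>. This is the
  factor lost when the competitor is h \<circ> f on Y.\<close>

lemma generalized_hurwitz_density_le:
  assumes \<Omega>: "proper_plane_domain \<Omega>" "w \<in> \<Omega>"
    and X: "proper_plane_domain X" "simply_connected X"
    and Y: "proper_plane_domain Y" "Y \<subseteq> X" "s \<in> Y"
    and c: "0 < c" "c < hurwitz_density X s / hurwitz_density Y s"
  shows "generalized_hurwitz_density Y \<Omega> w \<le> ereal (hurwitz_density \<Omega> w / c)"
proof -
  have oX: "open X" "X \<noteq> UNIV" "s \<in> X" and oY: "open Y"
    using X Y by (auto simp: proper_plane_domain_def plane_domain_def)
  obtain f g where f: "f holomorphic_on X" and g: "g holomorphic_on ball 0 1" and fs: "f s = 0"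
    and f_in: "\<And>z. z \<in> X \<Longrightarrow> f z \<in> ball 0 1 \<and> g (f z) = z"
    and g_in: "\<And>z. z \<in> ball 0 1 \<Longrightarrow> g z \<in> X \<and> f (g z) = z"
    using pointed_Riemann_map[of X s] oX X(2) by metis
  have g0: "g 0 = s" using f_in[OF oX(3)] fs by simp
  have df: "(f has_field_derivative deriv f s) (at s)" using holomorphic_derivI[OF f oX(1,3)] .
  have dg: "(g has_field_derivative deriv g 0) (at 0)"
    using holomorphic_derivI[OF g open_ball, of 0] by simp
  have "((g \<circ> f) has_field_derivative deriv g 0 * deriv f s) (at s)"
    using df dg fs by (intro DERIV_chain) auto
  \<comment> \<open>Near s the composition agrees with the identity, because X is open.\<close>
  moreover have "((g \<circ> f) has_field_derivative 1) (at s)"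
    by (rule DERIV_cong_ev[THEN iffD1, OF refl _ refl DERIV_ident])
      (use oX f_in in \<open>auto simp: eventually_nhds\<close>)
  ultimately have inv: "deriv g 0 * deriv f s = 1" using DERIV_unique by blast
  have "norm (deriv g 0) \<le> hurwitz_radius X s"
  proof (rule norm_deriv_le_hurwitz_radius[OF X(1) oX(3) g _ g0])
    show "g t \<noteq> s" if "t \<in> ball 0 1" "t \<noteq> 0" for t using g_in[OF that(1)] fs that by auto
    show "deriv g 0 \<noteq> 0" using inv by auto
  qed (use g_in in auto)
  then have rX: "1 \<le> hurwitz_radius X s * norm (deriv f s)"
    using inv by (metis mult_right_mono norm_ge_zero norm_mult norm_one)
  obtain h where h: "h \<in> hurwitz_family w \<Omega>" "deriv h 0 = complex_of_real (hurwitz_radius \<Omega> w)"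
    using hurwitz_radius_attained[OF \<Omega>] by metis
  note hD = hurwitz_familyD[OF h(1)]
  note pos = hurwitz_radius_pos[OF \<Omega>] hurwitz_radius_pos[OF X(1) oX(3)] hurwitz_radius_pos[OF Y(1,3)]
  have "(h has_field_derivative deriv h 0) (at (f s))"
    using holomorphic_derivI[OF hD(1) open_ball, of 0] fs by simp
  then have d: "deriv (h \<circ> f) s = deriv h 0 * deriv f s"
    using df by (intro DERIV_imp_deriv DERIV_chain)
  have "generalized_hurwitz_density Y \<Omega> w \<le> ereal (hurwitz_density Y s / norm (deriv (h \<circ> f) s))"
    unfolding generalized_hurwitz_density_def
  proof (rule Inf_lower, intro CollectI exI[of _ "h \<circ> f"] exI[of _ s] conjI refl)
    show "(h \<circ> f) holomorphic_on Y"
      using f_in Y(2) by (intro holomorphic_on_compose_gen[OF holomorphic_on_subset[OF f] hD(1)]) auto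
    show "(h \<circ> f) ` Y \<subseteq> \<Omega>" using f_in Y(2) hD(2) by auto
    show "(h \<circ> f) s = w" using fs hD(3) by simp
    \<comment> \<open>If h (f t) = w then f t = 0, and applying g gives t = g 0 = s.\<close>
    show "\<forall>t\<in>Y - {s}. (h \<circ> f) t \<noteq> w"
      using hD(4) f_in Y(2) fs g0 by fastforce
    show "deriv (h \<circ> f) s \<noteq> 0" using d h(2) inv pos by auto
  qed (rule Y(3))
  also have "hurwitz_density Y s / norm (deriv (h \<circ> f) s) \<le> hurwitz_density \<Omega> w / c"
  proof -
    have "c * hurwitz_radius X s \<le> hurwitz_radius Y s"
      using c(2) pos by (simp add: hurwitz_density_def field_simps)
    then have "c * hurwitz_radius X s * norm (deriv f s) \<le> hurwitz_radius Y s * norm (deriv f s)"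
      by (intro mult_right_mono) auto
    moreover have "c * 1 \<le> c * (hurwitz_radius X s * norm (deriv f s))"
      using rX c by (intro mult_left_mono) auto
    ultimately have "c \<le> hurwitz_radius Y s * norm (deriv f s)" by simp
    moreover have "deriv f s \<noteq> 0" using inv by auto
    ultimately show ?thesis
      using pos c(1) by (simp add: hurwitz_density_def d h(2) norm_mult field_simps)
  qed
  finally show ?thesis by simp
qed

theorem theorem4p6:
  fixes \<Omega> Y :: "complex set"
  assumes "proper_plane_domain \<Omega>"
    and "quasi_bounded Y"
    and "hurwitz_non_lipschitz_subdomain Y (simply_connected_hull Y)"
  shows "\<forall>w \<in> \<Omega>. generalized_hurwitz_density Y \<Omega> w = ereal (hurwitz_density \<Omega> w)"
proof (intro ballI antisym)
  fix w assume w: "w \<in> \<Omega>"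
  define X where "X = simply_connected_hull Y"
  have Y: "plane_domain Y" using assms(2) by (simp add: quasi_bounded_def)
  have X: "proper_plane_domain X" "simply_connected X" "Y \<subseteq> X"
    using assms(2) simply_connected_hull_properties[OF Y]
    by (auto simp: X_def quasi_bounded_def proper_plane_domain_def)
  have pY: "proper_plane_domain Y" using X Y by (auto simp: proper_plane_domain_def)
  have l: "1 \<le> hurwitz_contraction_constant Y X"
    using assms(3) by (auto simp: hurwitz_non_lipschitz_subdomain_def hurwitz_lipschitz_subdomain_def X_def)
  show "ereal (hurwitz_density \<Omega> w) \<le> generalized_hurwitz_density Y \<Omega> w"
    by (rule hurwitz_density_le_generalized[OF assms(1) w pY])
  show "generalized_hurwitz_density Y \<Omega> w \<le> ereal (hurwitz_density \<Omega> w)"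
  proof (rule ccontr)
    assume "\<not> ?thesis"
    then obtain b where b: "hurwitz_density \<Omega> w < b" "ereal b < generalized_hurwitz_density Y \<Omega> w"
      using ereal_dense2[of "ereal (hurwitz_density \<Omega> w)"] by (auto simp: not_le)
    \<comment> \<open>Chosen so that \<open>hurwitz_density \<Omega> w / c\<close> is exactly b. As
      c < 1, some s in Y has a ratio of densities above c, and the resulting bound b contradicts the
      choice of b.\<close>
    define c where "c = hurwitz_density \<Omega> w / b"
    have d: "hurwitz_density \<Omega> w > 0"
      using hurwitz_radius_pos[OF assms(1) w] by (simp add: hurwitz_density_def)
    have c: "0 < c" "c < 1" using b d by (auto simp: c_def)
    then have "ereal c < hurwitz_contraction_constant Y X" using l less_le_trans[of "ereal c" 1] by simp
    then obtain s where s: "s \<in> Y" "c < hurwitz_density X s / hurwitz_density Y s"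
      by (auto simp: hurwitz_contraction_constant_def less_SUP_iff)
    have "generalized_hurwitz_density Y \<Omega> w \<le> ereal (hurwitz_density \<Omega> w / c)"
      by (rule generalized_hurwitz_density_le[OF assms(1) w X(1,2) pY X(3) s(1) c(1) s(2)])
    with b(2) d show False by (simp add: c_def)
  qed
qed

end
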